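(* Let $\tau,\tau_r$ be types (sets), $f:\tau_r\times\tau\to\tau_r$ a function and $\mathcal I\in\tau_r$. If there exists a normalizer $h$ of $f$ satisfying $h(s,\mathcal I)=s$ for all $s\in\tau_r$, then both of the following hold: (1) for all $s\in\tau_r$ and $x\in\tau$: if $f(\mathcal I,x)=\mathcal I$, then $f(s,x)=s$; (2) for all $s\in\tau_r$ and $x,x'\in\tau$: if $f(\mathcal I,x)=f(\mathcal I,x')$, then $f(s,x)=f(s,x')$.
   Context: A normalizer of $f:\tau_r\times\tau\to\tau_r$ is a function $h:\tau_r\times\tau_r\to\tau_r$ such that $h(z,f(y,x))=f(h(z,y),x)$ for all $x\in\tau$ and $y,z\in\tau_r$. *)

theory Defs
  imports Main
begin

definition is_normalizer :: "('r \<Rightarrow> 'a \<Rightarrow> 'r) \<Rightarrow> ('r \<Rightarrow> 'r \<Rightarrow> 'r) \<Rightarrow> bool" where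
  "is_normalizer f h \<longleftrightarrow> (\<forall>x y z. h z (f y x) = f (h z y) x)"

end

theory Submission
  imports Defs
begin

text \<open>With \<open>I\<close> as a right unit of \<open>h\<close>, the normalizer law gives
  \<open>f s x = h s (f I x)\<close>: the action of \<open>x\<close> on any state \<open>s\<close>
  depends on \<open>x\<close> only through \<open>f I x\<close>. Equal values at \<open>I\<close>
  thus force equal values at \<open>s\<close>, and the value \<open>I\<close> gives
  \<open>h s I = s\<close>.\<close>

theorem theorem4p13:
  fixes f :: "'r \<Rightarrow> 'a \<Rightarrow> 'r" and I :: 'r
  assumes "\<exists>h. is_normalizer f h \<and> (\<forall>s. h s I = s)"
  shows "(\<forall>s x. f I x = I \<longrightarrow> f s x = s) \<and>
         (\<forall>s x x'. f I x = f I x' \<longrightarrow> f s x = f s x')"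
proof -
  obtain h where norm: "is_normalizer f h" and unit: "\<And>s. h s I = s"
    using assms by blast
  \<comment> \<open>The normalizer law at \<open>y = I\<close>, \<open>z = s\<close> turns the right
    side into \<open>f (h s I) x\<close>, where the unit law applies.\<close>
  have factor: "f s x = h s (f I x)" for s x
    using norm unit by (simp add: is_normalizer_def)
  show ?thesis
  proof (intro conjI allI impI)
    fix s x assume "f I x = I"
    then show "f s x = s"
      using factor[of s x] unit by simp
  next
    fix s x x' assume "f I x = f I x'"
    then show "f s x = f s x'"
      using factor[of s x] factor[of s x'] by simp
  qed
qed

end
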